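(* Let $S,T$ be nonempty subsets of $[n-1]$ such that $A=T_n\langle S;T\rangle$ is a walk-ensured Toeplitz matrix. Let $S^\ast,T^\ast$ be subsets of $[n-1]$ with $S\subseteq S^\ast$ and $T\subseteq T^\ast$. If $\gcd(S+T)=\gcd(S^\ast+T^\ast)$, then $T_n\langle S^\ast;T^\ast\rangle$ has matrix period $\gcd(S+T)/\gcd(S\cup T)$.
   Context: Matrices are Boolean ($0,1$ entries with $1+1=1$), and powers are Boolean matrix powers. For nonempty $S,T\subseteq[n-1]$, $T_n\langle S;T\rangle$ denotes the $n\times n$ $(0,1)$-matrix whose $(i,j)$-entry is $1$ if and only if $j-i\in S$ or $i-j\in T$. Its digraph $D(A)$ has vertex set $[n]$ and an arc $(i,j)$ exactly when the $(i,j)$-entry is $1$. $\gcd(S\cup T)$ is the gcd of all elements of $S\cup T$; $\gcd(S+T)=\gcd\{s+t: s\in S,t\in T\}$; $s_1=\min S$. The matrix $A$ is called walk-ensured if there is a positive integer $M$ such that for all vertices $u,v\in[n]$ and every integer $\ell\ge M$ with $v-u\equiv \ell s_1 \pmod{\gcd(S+T)}$, there is a directed walk from $u$ to $v$ of length $\ell$ in $D(A)$. The matrix period of a Boolean square matrix $A$ is the smallest positive integer $p$ for which there is $M$ with $A^m=A^{m+p}$ for all $m\ge M$. *)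

theory Defs
  imports
    "Jordan_Normal_Form.Matrix"
    "Graph_Theory.Arc_Walk"
    "HOL-Number_Theory.Cong"
begin

text \<open>
  The Boolean semiring, where \<open>1 + 1 = 1\<close>. With this instance, the product and powers of
  \<^typ>\<open>bool mat\<close> are the Boolean matrix product and Boolean matrix powers.
\<close>

instantiation bool :: comm_semiring_1
begin

definition zero_bool :: bool where "0 = False"
definition one_bool :: bool where "1 = True"
definition plus_bool :: "bool \<Rightarrow> bool \<Rightarrow> bool" where "a + b = (a \<or> b)"
definition times_bool :: "bool \<Rightarrow> bool \<Rightarrow> bool" where "a * b = (a \<and> b)"

instance
  by standard (auto simp: zero_bool_def one_bool_def plus_bool_def times_bool_def)

end

text \<open>Matrix indices start at 0 here; the entries depend only on differences of indices.\<close>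

definition toeplitz_mat :: "nat \<Rightarrow> nat set \<Rightarrow> nat set \<Rightarrow> bool mat" where
  "toeplitz_mat n S T =
     mat n n (\<lambda>(i, j). if int j - int i \<in> int ` S \<or> int i - int j \<in> int ` T then 1 else 0)"

text \<open>
  The vertices are \<open>1, \<dots>, n\<close>; vertex \<open>i\<close> corresponds to the matrix index \<open>i - 1\<close>.
\<close>

definition mat_digraph :: "bool mat \<Rightarrow> (nat, nat \<times> nat) pre_digraph" where
  "mat_digraph A =
     \<lparr>verts = {1..dim_row A},
      arcs = {(i, j). i \<in> {1..dim_row A} \<and> j \<in> {1..dim_row A} \<and> A $$ (i - 1, j - 1) = 1},
      tail = fst, head = snd\<rparr>"

definition gcd_sumset :: "nat set \<Rightarrow> nat set \<Rightarrow> nat" where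
  "gcd_sumset S T = Gcd {s + t | s t. s \<in> S \<and> t \<in> T}"

definition walk_ensured :: "nat \<Rightarrow> nat set \<Rightarrow> nat set \<Rightarrow> bool" where
  "walk_ensured n S T \<longleftrightarrow>
     (\<exists>M>0. \<forall>u\<in>{1..n}. \<forall>v\<in>{1..n}. \<forall>l\<ge>M.
        [int v - int u = int l * int (Min S)] (mod int (gcd_sumset S T)) \<longrightarrow>
        (\<exists>p. pre_digraph.awalk (mat_digraph (toeplitz_mat n S T)) u p v \<and> length p = l))"

definition eventual_period :: "bool mat \<Rightarrow> nat \<Rightarrow> bool" where
  "eventual_period A p \<longleftrightarrow> p > 0 \<and> (\<exists>M. \<forall>m\<ge>M. A ^\<^sub>m m = A ^\<^sub>m (m + p))"

definition has_matrix_period :: "bool mat \<Rightarrow> nat \<Rightarrow> bool" where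
  "has_matrix_period A p \<longleftrightarrow> eventual_period A p \<and> (\<forall>q. eventual_period A q \<longrightarrow> p \<le> q)"

end

theory Submission
  imports Defs
begin

text \<open>
  Put \<open>g = gcd (S + T)\<close>. All of \<open>S\<close> and \<open>- T\<close> lies in one residue class modulo \<open>g\<close>, that of
  \<open>min S\<close>, so a walk of length \<open>l\<close> from \<open>u\<close> to \<open>v\<close> forces \<open>v - u \<equiv> l \<sqdot> min S\<close> modulo \<open>g\<close>. As
  \<open>gcd (S' + T') = g\<close>, the steps of the larger matrix lie in the same class, and its additional
  arcs respect the constraint. For long walks, walk-ensuredness of the smaller matrix makes the
  constraint sufficient too. Hence the period is the additive order of \<open>min S\<close> modulo \<open>g\<close>, which
  is \<open>g / gcd (g, min S) = g / gcd (S \<union> T)\<close>.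
\<close>

lemma sum_bool_iff: "finite I \<Longrightarrow> (\<Sum>x\<in>I. f x) \<longleftrightarrow> (\<exists>x\<in>I. f x)" for f :: "'a \<Rightarrow> bool"
  by (induction rule: finite_induct) (auto simp: zero_bool_def plus_bool_def)

lemma index_mult_bool_mat:
  fixes A B :: "bool mat"
  assumes "A \<in> carrier_mat n n" "B \<in> carrier_mat n n" "i < n" "j < n"
  shows "(A * B) $$ (i, j) \<longleftrightarrow> (\<exists>k<n. A $$ (i, k) \<and> B $$ (k, j))"
proof -
  have "(A * B) $$ (i, j) = (\<Sum>k\<in>{0..<n}. A $$ (i, k) * B $$ (k, j))"
    using assms by (auto simp: scalar_prod_def intro!: sum.cong)
  then show ?thesis
    by (auto simp: sum_bool_iff times_bool_def)
qed

text \<open>\<open>pow_mat\<close> appends factors on the right, whereas induction over an arc list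
  removes the first arc; this moves the new factor to the left.\<close>

lemma pow_mat_Suc_left:
  fixes A :: "'a :: semiring_1 mat"
  assumes A: "A \<in> carrier_mat n n"
  shows "A ^\<^sub>m Suc k = A * A ^\<^sub>m k"
proof (induction k)
  case 0
  then show ?case using A by simp
next
  case (Suc k)
  have "A ^\<^sub>m Suc (Suc k) = (A * A ^\<^sub>m k) * A"
    using Suc by simp
  also have "\<dots> = A * A ^\<^sub>m Suc k"
    using A by (simp add: assoc_mult_mat[of _ n n _ n _ n])
  finally show ?case .
qed

lemma toeplitz_mat_carrier [simp]: "toeplitz_mat n S T \<in> carrier_mat n n"
  by (simp add: toeplitz_mat_def)

lemma index_toeplitz_mat:
  assumes "i < n" "j < n"
  shows "toeplitz_mat n S T $$ (i, j) \<longleftrightarrow> int j - int i \<in> int ` S \<or> int i - int j \<in> int ` T"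
  using assms by (simp add: toeplitz_mat_def one_bool_def zero_bool_def)

text \<open>Two matrices appear so that a walk in the digraph of the smaller one can be read off
  directly as an entry of a power of the larger one. The shift by 1 passes from vertices to
  indices.\<close>

lemma awalk_imp_pow_mat:
  fixes A B :: "bool mat"
  assumes A: "A \<in> carrier_mat n n" and B: "B \<in> carrier_mat n n"
    and mono: "\<And>i j. i < n \<Longrightarrow> j < n \<Longrightarrow> A $$ (i, j) \<Longrightarrow> B $$ (i, j)"
    and "pre_digraph.awalk (mat_digraph A) u p v"
  shows "(B ^\<^sub>m length p) $$ (u - 1, v - 1)"
  using assms(4)
proof (induction p arbitrary: u)
  case Nil
  then show ?case
    using A B
    by (auto simp: pre_digraph.awalk_def pre_digraph.cas.simps mat_digraph_def one_bool_def)
next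
  case (Cons e p)
  obtain w where e: "e = (u, w)" and u: "u \<in> {1..n}" and w: "w \<in> {1..n}"
    and arc: "A $$ (u - 1, w - 1)" and walk: "pre_digraph.awalk (mat_digraph A) w p v"
    using Cons.prems A
    by (cases e) (auto simp: pre_digraph.awalk_def pre_digraph.cas.simps mat_digraph_def one_bool_def)
  \<comment> \<open>Matrix products are evaluated only at indices below \<open>n\<close>, so the end
    of the walk must be located as well.\<close>
  have v: "v \<in> {1..n}"
    using walk A w
  proof (induction p arbitrary: w)
    case (Cons e p)
    then show ?case
      by (cases e) (auto simp: pre_digraph.awalk_def pre_digraph.cas.simps mat_digraph_def)
  qed (auto simp: pre_digraph.awalk_def pre_digraph.cas.simps mat_digraph_def)
  have "B $$ (u - 1, w - 1)" "(B ^\<^sub>m length p) $$ (w - 1, v - 1)"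
    using mono[OF _ _ arc] u w Cons.IH[OF walk] by auto
  moreover have "u - 1 < n" "v - 1 < n" "w - 1 < n"
    using u v w by auto
  ultimately show ?case
    using B index_mult_bool_mat[OF B pow_carrier_mat[OF B], of "u - 1" "v - 1" "length p"]
    by (auto simp: pow_mat_Suc_left[OF B] simp del: pow_mat.simps)
qed

text \<open>Each step moves the index by some \<open>s\<close> or \<open>- t\<close>, hence by
  \<open>c\<close> modulo \<open>g\<close>, and the \<open>l\<close> steps telescope.\<close>

lemma cong_of_toeplitz_pow:
  fixes c g :: int
  assumes S: "\<And>s. s \<in> S \<Longrightarrow> [int s = c] (mod g)" and T: "\<And>t. t \<in> T \<Longrightarrow> [- int t = c] (mod g)"
    and "i < n" "j < n" "(toeplitz_mat n S T ^\<^sub>m l) $$ (i, j)"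
  shows "[int j - int i = int l * c] (mod g)"
  using assms(4,5)
proof (induction l arbitrary: j)
  case 0
  then show ?case
    using \<open>i < n\<close> by (cases "i = j") (auto simp: toeplitz_mat_def zero_bool_def)
next
  case (Suc l)
  then obtain k where k: "k < n" "(toeplitz_mat n S T ^\<^sub>m l) $$ (i, k)" "toeplitz_mat n S T $$ (k, j)"
    using \<open>i < n\<close> index_mult_bool_mat[of "toeplitz_mat n S T ^\<^sub>m l" n "toeplitz_mat n S T" i j]
    by auto
  have step: "[int j - int k = c] (mod g)"
    \<comment> \<open>Rewriting \<open>int j - int k\<close> as a negated difference puts a backward
      step into the form \<open>- int t\<close>.\<close>
    using k Suc.prems S T by (force simp: index_toeplitz_mat minus_diff_eq[of "int k", symmetric]
        simp del: minus_diff_eq)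
  have "[(int k - int i) + (int j - int k) = int l * c + c] (mod g)"
    by (intro cong_add Suc.IH k step)
  then show ?case
    by (simp add: algebra_simps)
qed

lemma gcd_sumset_dvd: "s \<in> S \<Longrightarrow> t \<in> T \<Longrightarrow> gcd_sumset S T dvd s + t"
  unfolding gcd_sumset_def by (rule Gcd_dvd) blast

lemma cong_gcd_sumset:
  assumes "s \<in> S" "s' \<in> S" "t \<in> T"
  shows "[int s = int s'] (mod int (gcd_sumset S T))" "[- int t = int s'] (mod int (gcd_sumset S T))"
proof -
  have *: "int (gcd_sumset S T) dvd int s + int t" "int (gcd_sumset S T) dvd int s' + int t"
    using gcd_sumset_dvd assms by (metis int_dvd_int_iff of_nat_add)+
  have "int s - int s' = (int s + int t) - (int s' + int t)"
    by simp
  with * show "[int s = int s'] (mod int (gcd_sumset S T))"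
    by (metis cong_iff_dvd_diff dvd_diff)
  have "- int t - int s' = - (int s' + int t)"
    by simp
  with * show "[- int t = int s'] (mod int (gcd_sumset S T))"
    by (metis cong_iff_dvd_diff dvd_minus_iff)
qed

text \<open>A common divisor of all sums and of one \<open>s\<close> divides each
  \<open>t = (s + t) - s\<close>, and then each \<open>s' = (s' + t) - t\<close>.\<close>

lemma gcd_gcd_sumset:
  assumes "s \<in> S" "T \<noteq> {}"
  shows "gcd (gcd_sumset S T) s = Gcd (S \<union> T)"
proof (rule dvd_antisym)
  have *: "gcd (gcd_sumset S T) s dvd t" if "t \<in> T" for t
    by (metis assms(1) dvd_add_right_iff dvd_trans gcd_dvd1 gcd_dvd2 gcd_sumset_dvd that)
  obtain t where t: "t \<in> T"
    using \<open>T \<noteq> {}\<close> by blast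
  have "gcd (gcd_sumset S T) s dvd s'" if "s' \<in> S" for s'
    by (metis *[OF t] dvd_add_left_iff dvd_trans gcd_dvd1 gcd_sumset_dvd that t)
  with * show "gcd (gcd_sumset S T) s dvd Gcd (S \<union> T)"
    by (auto intro!: Gcd_greatest)
  have "Gcd (S \<union> T) dvd gcd_sumset S T"
    unfolding gcd_sumset_def by (rule Gcd_greatest) (auto intro: dvd_add Gcd_dvd)
  then show "Gcd (S \<union> T) dvd gcd (gcd_sumset S T) s"
    using assms by (auto intro: Gcd_dvd)
qed

text \<open>This computes the additive order of \<open>s\<close> modulo \<open>g\<close>: cancelling
  the gcd leaves coprime cofactors.\<close>

lemma dvd_mult_iff_div_gcd_dvd:
  fixes g s q :: nat
  assumes "g > 0"
  shows "g dvd q * s \<longleftrightarrow> g div gcd g s dvd q"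
proof -
  define d where "d = gcd g s"
  have d: "d > 0" "g = d * (g div d)" "s = d * (s div d)"
    using assms by (auto simp: d_def)
  have "coprime (g div d) (s div d)"
    using assms unfolding d_def by (intro div_gcd_coprime) auto
  moreover have "g dvd q * s \<longleftrightarrow> g div d dvd q * (s div d)"
    using d by (metis dvd_times_left_cancel_iff mult.left_commute not_less_zero)
  ultimately show ?thesis
    by (simp add: d_def coprime_dvd_mult_left_iff)
qed

theorem theorem4p2:
  fixes n :: nat and S T S' T' :: "nat set"
  assumes "S \<noteq> {}" and "S \<subseteq> {1..n - 1}"
    and "T \<noteq> {}" and "T \<subseteq> {1..n - 1}"
    and "walk_ensured n S T"
    and "S' \<subseteq> {1..n - 1}" and "T' \<subseteq> {1..n - 1}"
    and "S \<subseteq> S'" and "T \<subseteq> T'"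
    and "gcd_sumset S T = gcd_sumset S' T'"
  shows "has_matrix_period (toeplitz_mat n S' T') (gcd_sumset S T div Gcd (S \<union> T))"
proof -
  define g where "g = gcd_sumset S T"
  define s where "s = Min S"
  define A where "A = toeplitz_mat n S' T'"
  have A: "A \<in> carrier_mat n n"
    by (simp add: A_def)
  have s: "s \<in> S" "s \<in> S'"
    using assms(1,2,8) Min_in[of S] finite_subset[of S "{1..n - 1}"] unfolding s_def by blast+
  obtain t where t: "t \<in> T" "t \<in> T'"
    using assms by blast
  have n: "n > 0"
    using s assms by (cases n) auto
  have g_pos: "g > 0"
  proof (rule ccontr)
    assume "\<not> g > 0"
    then have "s + t = 0"
      using gcd_sumset_dvd[OF s(1) t(1)] by (simp add: g_def)
    then show False
      using s assms by auto
  qed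
  have div_eq: "g div Gcd (S \<union> T) = g div gcd g s"
    using gcd_gcd_sumset[OF s(1) \<open>T \<noteq> {}\<close>] by (simp add: g_def)
  \<comment> \<open>The equality of the two gcds enters here: the steps of the larger matrix obey
    the congruence modulo the same \<open>g\<close>.\<close>
  have cong_S: "[int x = int s] (mod int g)" if "x \<in> S'" for x
    using cong_gcd_sumset(1)[OF that s(2) t(2)] assms by (simp add: g_def)
  have cong_T: "[- int y = int s] (mod int g)" if "y \<in> T'" for y
    using cong_gcd_sumset(2)[OF s(2) s(2) that] assms by (simp add: g_def)

  obtain M where M: "\<And>u v l. u \<in> {1..n} \<Longrightarrow> v \<in> {1..n} \<Longrightarrow> l \<ge> M \<Longrightarrow>
      [int v - int u = int l * int s] (mod int g) \<Longrightarrow>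
      \<exists>p. pre_digraph.awalk (mat_digraph (toeplitz_mat n S T)) u p v \<and> length p = l"
    using assms(5) unfolding walk_ensured_def g_def s_def by blast
  \<comment> \<open>Necessity comes from the steps in \<open>S'\<close> and \<open>T'\<close>;
    sufficiency from a walk that uses only steps in \<open>S\<close> and \<open>T\<close>.\<close>
  have pow_iff: "(A ^\<^sub>m l) $$ (i, j) \<longleftrightarrow> [int j - int i = int l * int s] (mod int g)"
    if lij: "l \<ge> M" "i < n" "j < n" for l i j
  proof
    assume "(A ^\<^sub>m l) $$ (i, j)"
    then show "[int j - int i = int l * int s] (mod int g)"
      using lij cong_of_toeplitz_pow[OF cong_S cong_T] unfolding A_def by blast
  next
    assume "[int j - int i = int l * int s] (mod int g)"
    then obtain p where "pre_digraph.awalk (mat_digraph (toeplitz_mat n S T)) (Suc i) p (Suc j)"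
      and p: "length p = l"
      using M[of "Suc i" "Suc j" l] lij by auto
    then have "(A ^\<^sub>m length p) $$ (Suc i - 1, Suc j - 1)"
      using assms(8,9)
      by (intro awalk_imp_pow_mat[OF toeplitz_mat_carrier A]) (auto simp: A_def index_toeplitz_mat)
    then show "(A ^\<^sub>m l) $$ (i, j)"
      using p by simp
  qed
  have order_iff: "[int q * int s = 0] (mod int g) \<longleftrightarrow> g div gcd g s dvd q" for q
    using dvd_mult_iff_div_gcd_dvd[OF g_pos, of q s]
    by (simp add: cong_0_iff flip: of_nat_mult)

  have "A ^\<^sub>m m = A ^\<^sub>m (m + g div gcd g s)" if "m \<ge> M" for m
  proof (rule eq_matI)
    fix i j assume "i < dim_row (A ^\<^sub>m (m + g div gcd g s))" "j < dim_col (A ^\<^sub>m (m + g div gcd g s))"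
    then have ij: "i < n" "j < n"
      by (simp_all only: pow_mat_dim_square[OF A])
    \<comment> \<open>Lengthening by the order of \<open>s\<close> leaves the residue, and so every
      entry, unchanged.\<close>
    have "[int m * int s + int (g div gcd g s) * int s = int m * int s + 0] (mod int g)"
      by (intro cong_add cong_refl) (simp only: order_iff dvd_refl)
    then have "[int (m + g div gcd g s) * int s = int m * int s] (mod int g)"
      by (simp add: distrib_right)
    then show "(A ^\<^sub>m m) $$ (i, j) = (A ^\<^sub>m (m + g div gcd g s)) $$ (i, j)"
      using that ij by (auto simp only: pow_iff trans_le_add1 intro: cong_trans cong_sym)
  qed (simp_all only: pow_mat_dim_square[OF A])
  moreover have "g div gcd g s > 0"
    using g_pos by (simp add: div_greater_zero_iff gcd_le1_nat)
  ultimately have "eventual_period A (g div gcd g s)"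
    unfolding eventual_period_def by blast
  moreover have "g div gcd g s \<le> q" if "eventual_period A q" for q
  proof -
    from that obtain K where q: "q > 0" and K: "\<And>m. m \<ge> K \<Longrightarrow> A ^\<^sub>m m = A ^\<^sub>m (m + q)"
      unfolding eventual_period_def by blast
    \<comment> \<open>A multiple of \<open>g\<close> past both thresholds: its residue is 0, so the
      entry at \<open>(0, 0)\<close> is true. Periodicity carries this entry to
      \<open>m + q\<close>, which forces \<open>q * s\<close> to vanish modulo
      \<open>g\<close>.\<close>
    define m where "m = g * (K + M)"
    have "K + M \<le> m"
      using g_pos unfolding m_def by (cases g) auto
    then have m: "m \<ge> K" "m \<ge> M"
      by auto
    have m_cong: "[int m * int s = 0] (mod int g)"
      by (simp add: m_def cong_0_iff)
    then have "(A ^\<^sub>m m) $$ (0, 0)"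
      using n m cong_sym[OF m_cong] by (simp add: pow_iff)
    then have "(A ^\<^sub>m (m + q)) $$ (0, 0)"
      by (simp only: K[OF m(1), symmetric])
    then have "[int (m + q) * int s = 0] (mod int g)"
      using n m pow_iff[of "m + q" 0 0] by (simp add: cong_0_iff cong_sym_eq[of 0])
    then have "[int q * int s = 0] (mod int g)"
      using m_cong by (simp add: cong_0_iff distrib_right dvd_add_right_iff)
    then show ?thesis
      using q by (simp add: order_iff dvd_imp_le)
  qed
  ultimately show ?thesis
    unfolding has_matrix_period_def A_def g_def[symmetric] div_eq by blast
qed

end
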